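(* Let $\mathcal A$ be a unitary operator on $\mathcal H$ (a quantum algorithm that uses no measurements), let $\chi:\mathbb Z\to\{0,1\}$ be a Boolean function, let $\mathcal A|\mathbf 0\rangle=|\Psi\rangle=|\Psi^a\rangle+|\Psi^b\rangle$, and let $\mathbf Q=-\mathcal A\,\mathbf S_0\,\mathcal A^{-1}\,\mathbf S_\chi$. Then, for all integers $j\ge0$, $$\mathbf Q^j\mathcal A|\mathbf 0\rangle=k_j|\Psi^a\rangle+\ell_j|\Psi^b\rangle,$$ where $$k_j=\frac1{\sqrt a}\sin((2j+1)\theta)\quad\text{and}\quad \ell_j=\frac1{\sqrt{1-a}}\cos((2j+1)\theta),$$ and where $\theta$ is defined so that $\sin^2\theta=a=\langle\Psi^a|\Psi^a\rangle$ and $0\le\theta\le\pi/2$. (If $a=0$ then $|\Psi^a\rangle=0$ and the term $k_j|\Psi^a\rangle$ is read as $0$; if $a=1$ then $|\Psi^b\rangle=0$ and the term $\ell_j|\Psi^b\rangle$ is read as $0$.)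
   Context: Setting. $\mathcal H$ is the state space of a joint quantum system whose first subsystem has orthonormal basis states $|i\rangle$ indexed by integers $i$; every pure state is a superposition $\sum_{i\in\mathbb Z}x_i|i\rangle|\Upsilon_i\rangle$ with only finitely many nonzero amplitudes $x_i$. $|\mathbf 0\rangle\in\mathcal H$ is the fixed all-zero initial state (a unit vector). Given $\chi:\mathbb Z\to\{0,1\}$, a state $|i\rangle|\cdot\rangle$ is good if $\chi(i)=1$ and bad if $\chi(i)=0$. $|\Psi^a\rangle$ and $|\Psi^b\rangle$ are the orthogonal projections of $|\Psi\rangle$ onto the span of the good, respectively bad, states. $\mathbf S_\chi$ is the unitary with $|i\rangle|\cdot\rangle\mapsto(-1)^{\chi(i)}|i\rangle|\cdot\rangle$, and $\mathbf S_0=\mathbf I-2|\mathbf 0\rangle\langle\mathbf 0|$. *)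

theory Defs
  imports Complex_Main "HOL-Library.Poly_Mapping"
begin

text \<open>
  Complex inner product spaces, in the bra-ket convention: \<open>cinner x y\<close> is
  conjugate-linear in \<open>x\<close> and linear in \<open>y\<close>. Completeness is not
  required, so Hilbert spaces are a special case. (Conjugate symmetry makes
  \<open>cinner x x\<close> real.)
\<close>

class complex_inner = ab_group_add +
  fixes scaleC :: "complex \<Rightarrow> 'a \<Rightarrow> 'a" (infixr \<open>*\<^sub>C\<close> 75)
    and cinner :: "'a \<Rightarrow> 'a \<Rightarrow> complex"
  assumes scaleC_add_right: "c *\<^sub>C (x + y) = c *\<^sub>C x + c *\<^sub>C y"
    and scaleC_add_left: "(c + d) *\<^sub>C x = c *\<^sub>C x + d *\<^sub>C x"
    and scaleC_scaleC: "c *\<^sub>C d *\<^sub>C x = (c * d) *\<^sub>C x"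
    and scaleC_one: "1 *\<^sub>C x = x"
    and cinner_commute: "cinner x y = cnj (cinner y x)"
    and cinner_add_right: "cinner x (y + z) = cinner x y + cinner x z"
    and cinner_scaleC_right: "cinner x (c *\<^sub>C y) = c * cinner x y"
    and cinner_ge_zero: "0 \<le> Re (cinner x x)"
    and cinner_eq_zero_iff: "cinner x x = 0 \<longleftrightarrow> x = 0"

global_interpretation cvec: vector_space "scaleC :: complex \<Rightarrow> 'a \<Rightarrow> 'a::complex_inner"
  by unfold_locales
    (simp_all add: scaleC_add_right scaleC_add_left scaleC_scaleC scaleC_one)

lemma cinner_zero_right [simp]: "cinner x (0::'a::complex_inner) = 0"
  using cinner_add_right[of x 0 0] by simp

lemma cinner_zero_left [simp]: "cinner (0::'a::complex_inner) x = 0"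
  using cinner_commute[of 0 x] by simp

lemma cinner_diff_right:
  "cinner x (y - z) = cinner x y - cinner x (z::'a::complex_inner)"
  using cinner_add_right[of x "y - z" z] by simp

definition is_unitary :: "('a::complex_inner \<Rightarrow> 'a) \<Rightarrow> bool" where
  "is_unitary U \<longleftrightarrow> Vector_Spaces.linear scaleC scaleC U \<and> bij U \<and>
     (\<forall>x y. cinner (U x) (U y) = cinner x y)"

definition is_orth_proj :: "'a::complex_inner set \<Rightarrow> 'a \<Rightarrow> 'a \<Rightarrow> bool" where
  "is_orth_proj V x p \<longleftrightarrow> p \<in> V \<and> (\<forall>v\<in>V. cinner v (x - p) = 0)"

text \<open>
  Only meaningful if \<open>V\<close> is a subspace and the projection of \<open>x\<close> exists
  (then it is unique, by \<open>is_orth_proj_unique\<close>); for the subspaces used below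
  existence is shown in \<open>orth_proj_good_bad\<close>.
\<close>

definition orth_proj :: "'a::complex_inner set \<Rightarrow> 'a \<Rightarrow> 'a" where
  "orth_proj V x = (THE p. is_orth_proj V x p)"

lemma is_orth_proj_unique:
  assumes "cvec.subspace V" "is_orth_proj V x p" "is_orth_proj V x q"
  shows "p = q"
proof -
  have "p - q \<in> V"
    using assms by (simp add: is_orth_proj_def cvec.subspace_diff)
  then have "cinner (p - q) (x - p) = 0" "cinner (p - q) (x - q) = 0"
    using assms by (simp_all add: is_orth_proj_def)
  then have "cinner (p - q) ((x - q) - (x - p)) = 0"
    by (simp only: cinner_diff_right) simp
  then have "cinner (p - q) (p - q) = 0"
    by simp
  then show ?thesis
    by (simp add: cinner_eq_zero_iff)
qed

lemma orth_proj_eqI: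
  assumes "cvec.subspace V" "is_orth_proj V x p"
  shows "orth_proj V x = p"
  unfolding orth_proj_def using assms is_orth_proj_unique by blast

text \<open>
  The joint state space, with \<open>'k\<close> the state space of the second subsystem: the
  finitely supported function \<open>x\<close> stands for the superposition
  \<open>\<Sum>i. |i\<rangle> (lookup x i)\<close> (amplitudes absorbed into the second factor). The
  inner product makes the \<open>|i\<rangle>\<close> orthonormal.
\<close>

type_synonym 'k joint = "int \<Rightarrow>\<^sub>0 'k"

instantiation poly_mapping :: (type, complex_inner) complex_inner
begin

definition scaleC_poly_mapping ::
    "complex \<Rightarrow> ('a \<Rightarrow>\<^sub>0 'b) \<Rightarrow> ('a \<Rightarrow>\<^sub>0 'b)" where
  "c *\<^sub>C x = Poly_Mapping.map (scaleC c) x"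

definition cinner_poly_mapping ::
    "('a \<Rightarrow>\<^sub>0 'b) \<Rightarrow> ('a \<Rightarrow>\<^sub>0 'b) \<Rightarrow> complex" where
  "cinner x y = (\<Sum>i\<in>Poly_Mapping.keys x. cinner (Poly_Mapping.lookup x i) (Poly_Mapping.lookup y i))"

lemma lookup_scaleC:
  "Poly_Mapping.lookup (c *\<^sub>C x) i = c *\<^sub>C Poly_Mapping.lookup (x::'a \<Rightarrow>\<^sub>0 'b) i"
  by (simp add: scaleC_poly_mapping_def Poly_Mapping.map.rep_eq when_def)

lemma cinner_poly_mapping_superset:
  assumes "finite S" "Poly_Mapping.keys x \<subseteq> S"
  shows "cinner x (y::'a \<Rightarrow>\<^sub>0 'b) =
    (\<Sum>i\<in>S. cinner (Poly_Mapping.lookup x i) (Poly_Mapping.lookup y i))"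
  unfolding cinner_poly_mapping_def
  by (rule sum.mono_neutral_left) (use assms in \<open>auto simp: in_keys_iff\<close>)

instance
proof
  fix c d :: complex and x y z :: "'a \<Rightarrow>\<^sub>0 'b"
  show "c *\<^sub>C (x + y) = c *\<^sub>C x + c *\<^sub>C y"
    by (rule poly_mapping_eqI) (simp add: lookup_scaleC lookup_add scaleC_add_right)
  show "(c + d) *\<^sub>C x = c *\<^sub>C x + d *\<^sub>C x"
    by (rule poly_mapping_eqI) (simp add: lookup_scaleC lookup_add scaleC_add_left)
  show "c *\<^sub>C d *\<^sub>C x = (c * d) *\<^sub>C x"
    by (rule poly_mapping_eqI) (simp add: lookup_scaleC scaleC_scaleC)
  show "1 *\<^sub>C x = x"
    by (rule poly_mapping_eqI) (simp add: lookup_scaleC scaleC_one)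
  let ?S = "Poly_Mapping.keys x \<union> Poly_Mapping.keys y"
  have "cinner x y = (\<Sum>i\<in>?S. cinner (Poly_Mapping.lookup x i) (Poly_Mapping.lookup y i))"
    by (rule cinner_poly_mapping_superset) auto
  also have "\<dots> = (\<Sum>i\<in>?S. cnj (cinner (Poly_Mapping.lookup y i) (Poly_Mapping.lookup x i)))"
    by (rule sum.cong[OF refl]) (rule cinner_commute)
  also have "\<dots> = cnj (cinner y x)"
    by (subst cinner_poly_mapping_superset[of ?S y]) auto
  finally show "cinner x y = cnj (cinner y x)" .
  show "cinner x (y + z) = cinner x y + cinner x z"
    by (simp add: cinner_poly_mapping_def lookup_add cinner_add_right sum.distrib)
  show "cinner x (c *\<^sub>C y) = c * cinner x y"
    by (simp add: cinner_poly_mapping_def lookup_scaleC cinner_scaleC_right sum_distrib_left)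
  show "0 \<le> Re (cinner x x)"
    by (simp add: cinner_poly_mapping_def sum_nonneg cinner_ge_zero)
  show "cinner x x = 0 \<longleftrightarrow> x = 0"
  proof
    assume "cinner x x = 0"
    then have "(\<Sum>i\<in>Poly_Mapping.keys x. Re (cinner (Poly_Mapping.lookup x i) (Poly_Mapping.lookup x i))) = 0"
      by (simp add: cinner_poly_mapping_def flip: Re_sum)
    then have *: "\<forall>i\<in>Poly_Mapping.keys x. Re (cinner (Poly_Mapping.lookup x i) (Poly_Mapping.lookup x i)) = 0"
      by (subst (asm) sum_nonneg_eq_0_iff) (auto simp: cinner_ge_zero)
    have "Poly_Mapping.lookup x i = 0" for i
    proof (cases "i \<in> Poly_Mapping.keys x")
      case True
      have "Im (cinner (Poly_Mapping.lookup x i) (Poly_Mapping.lookup x i)) = 0"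
        using arg_cong[OF cinner_commute, of Im "Poly_Mapping.lookup x i" "Poly_Mapping.lookup x i"] by simp
      with * True have "cinner (Poly_Mapping.lookup x i) (Poly_Mapping.lookup x i) = 0"
        by (simp add: complex_eq_iff)
      then show ?thesis
        by (simp add: cinner_eq_zero_iff)
    qed (simp add: in_keys_iff)
    then show "x = 0"
      by (simp add: poly_mapping_eqI)
  qed (simp add: cinner_poly_mapping_def)
qed

end

abbreviation ket :: "int \<Rightarrow> 'k::complex_inner \<Rightarrow> 'k joint" where
  "ket i v \<equiv> Poly_Mapping.single i v"

definition good_space :: "(int \<Rightarrow> nat) \<Rightarrow> 'k::complex_inner joint set" where
  "good_space \<chi> = cvec.span {ket i v | i v. \<chi> i = 1}"

definition bad_space :: "(int \<Rightarrow> nat) \<Rightarrow> 'k::complex_inner joint set" where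
  "bad_space \<chi> = cvec.span {ket i v | i v. \<chi> i = 0}"

definition S_chi :: "(int \<Rightarrow> nat) \<Rightarrow> 'k::complex_inner joint \<Rightarrow> 'k joint" where
  "S_chi \<chi> = Poly_Mapping.mapp (\<lambda>i v. (- 1) ^ \<chi> i *\<^sub>C v)"

definition S_zero :: "'a::complex_inner \<Rightarrow> 'a \<Rightarrow> 'a" where
  "S_zero z x = x - (2 * cinner z x) *\<^sub>C z"

definition Q_op ::
    "('k::complex_inner joint \<Rightarrow> 'k joint) \<Rightarrow> 'k joint \<Rightarrow> (int \<Rightarrow> nat) \<Rightarrow> 'k joint \<Rightarrow> 'k joint" where
  "Q_op A z \<chi> x = - A (S_zero z (inv A (S_chi \<chi> x)))"

lemma lookup_S_chi:
  "Poly_Mapping.lookup (S_chi \<chi> x) i = (- 1) ^ \<chi> i *\<^sub>C Poly_Mapping.lookup x i"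
  by (simp add: S_chi_def lookup_mapp when_def in_keys_iff)

lemma S_chi_ket: "S_chi \<chi> (ket i v) = (- 1) ^ \<chi> i *\<^sub>C ket i v"
  by (rule poly_mapping_eqI) (simp add: lookup_S_chi lookup_scaleC lookup_single when_def)

lemma is_unitary_S_chi: "is_unitary (S_chi \<chi> :: 'k::complex_inner joint \<Rightarrow> 'k joint)"
proof -
  have inv: "S_chi \<chi> (S_chi \<chi> x) = x" for x :: "'k joint"
    by (rule poly_mapping_eqI)
      (simp add: lookup_S_chi scaleC_scaleC scaleC_one flip: power_add mult_2)
  have "bij (S_chi \<chi> :: 'k joint \<Rightarrow> 'k joint)"
    by (rule o_bij[of "S_chi \<chi>"]) (auto simp: fun_eq_iff inv)
  moreover have "Vector_Spaces.linear scaleC scaleC (S_chi \<chi> :: 'k joint \<Rightarrow> 'k joint)"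
    by unfold_locales
      (auto intro!: poly_mapping_eqI
        simp: lookup_S_chi lookup_add lookup_scaleC scaleC_add_right scaleC_scaleC mult.commute)
  moreover have "cinner (S_chi \<chi> x) (S_chi \<chi> y) = cinner x y" for x y :: "'k joint"
  proof -
    have *: "cinner (s *\<^sub>C u) (s *\<^sub>C v) = (cnj s * s) * cinner u v" for s and u v :: 'k
      using cinner_commute[of "s *\<^sub>C u" v] cinner_commute[of u v]
      by (simp add: cinner_scaleC_right)
    have "Poly_Mapping.keys (S_chi \<chi> x) \<subseteq> Poly_Mapping.keys x"
      by (auto simp: in_keys_iff lookup_S_chi)
    then show ?thesis
      by (subst cinner_poly_mapping_superset[of "Poly_Mapping.keys x"])
        (auto simp: lookup_S_chi * cinner_poly_mapping_def simp flip: power_mult_distrib)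
  qed
  ultimately show ?thesis
    by (simp add: is_unitary_def)
qed

lemma is_orth_proj_span_ket:
  fixes x :: "'k::complex_inner joint"
  shows "is_orth_proj (cvec.span {ket i v | i v. P i}) x (Poly_Mapping.mapp (\<lambda>i v. if P i then v else 0) x)"
    (is "is_orth_proj (cvec.span ?B) x ?p")
proof -
  have p: "Poly_Mapping.lookup ?p i = (if P i then Poly_Mapping.lookup x i else 0)" for i
    by (simp add: lookup_mapp when_def in_keys_iff)
  have "?p = (\<Sum>i\<in>Poly_Mapping.keys ?p. ket i (Poly_Mapping.lookup ?p i))"
    by (rule poly_mapping_eqI)
      (auto simp: lookup_sum lookup_single when_def in_keys_iff sum.delta')
  moreover have "\<dots> \<in> cvec.span ?B"
    by (rule cvec.span_sum, rule cvec.span_base) (auto simp: in_keys_iff p split: if_splits)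
  moreover have "cinner v (x - ?p) = 0" if "v \<in> cvec.span ?B" for v
  proof -
    have "Poly_Mapping.lookup v i = 0" if "\<not> P i" for i
      using \<open>v \<in> cvec.span ?B\<close>
      by (induction rule: cvec.span_induct_alt)
        (use that in \<open>auto simp: lookup_add lookup_scaleC lookup_single when_def split: if_splits\<close>)
    then show ?thesis
      by (auto simp: cinner_poly_mapping_def lookup_minus p intro!: sum.neutral)
  qed
  ultimately show ?thesis
    by (simp add: is_orth_proj_def)
qed

lemma orth_proj_good_bad:
  fixes x :: "'k::complex_inner joint"
  assumes "\<And>i. \<chi> i \<in> {0, 1}"
  shows "is_orth_proj (good_space \<chi>) x (orth_proj (good_space \<chi>) x)"
    and "is_orth_proj (bad_space \<chi>) x (orth_proj (bad_space \<chi>) x)"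
    and "x = orth_proj (good_space \<chi>) x + orth_proj (bad_space \<chi>) x"
proof -
  have g: "is_orth_proj (good_space \<chi>) x (Poly_Mapping.mapp (\<lambda>i v. if \<chi> i = 1 then v else 0) x)"
    (is "is_orth_proj _ _ ?g")
    unfolding good_space_def by (rule is_orth_proj_span_ket)
  have b: "is_orth_proj (bad_space \<chi>) x (Poly_Mapping.mapp (\<lambda>i v. if \<chi> i = 0 then v else 0) x)"
    (is "is_orth_proj _ _ ?b")
    unfolding bad_space_def by (rule is_orth_proj_span_ket)
  have ge: "orth_proj (good_space \<chi>) x = ?g"
    by (rule orth_proj_eqI[OF _ g]) (simp add: good_space_def)
  have be: "orth_proj (bad_space \<chi>) x = ?b"
    by (rule orth_proj_eqI[OF _ b]) (simp add: bad_space_def)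
  show "is_orth_proj (good_space \<chi>) x (orth_proj (good_space \<chi>) x)"
    using g ge by simp
  show "is_orth_proj (bad_space \<chi>) x (orth_proj (bad_space \<chi>) x)"
    using b be by simp
  show "x = orth_proj (good_space \<chi>) x + orth_proj (bad_space \<chi>) x"
    unfolding ge be
  proof (rule poly_mapping_eqI)
    fix i
    show "Poly_Mapping.lookup x i = Poly_Mapping.lookup (?g + ?b) i"
      using assms[of i] by (auto simp: lookup_add lookup_mapp when_def in_keys_iff)
  qed
qed

end

(*
  Q acts on the plane spanned by the good and the bad component of the initial state. Moving A
  through the reflection S_0 gives Q x = -S_chi x + 2 <Psi|S_chi x> Psi, and with a = sin^2 theta
  this is a rotation by 2 theta in the normalised components, so the coefficients follow from the
  addition theorems for sine and cosine.
*)

theory Submission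
  imports Defs
begin

lemma cinner_add_left:
  "cinner (x + y) z = cinner x z + cinner y (z::'a::complex_inner)"
  by (metis cinner_add_right cinner_commute complex_cnj_add)

lemma S_chi_linear:
  "Vector_Spaces.linear scaleC scaleC (S_chi \<chi> :: 'k::complex_inner joint \<Rightarrow> 'k joint)"
  by (rule is_unitary_S_chi[unfolded is_unitary_def, THEN conjunct1])

lemma S_chi_good_space:
  assumes "v \<in> good_space \<chi>"
  shows "S_chi \<chi> v = - v"
proof -
  interpret S: Vector_Spaces.linear scaleC scaleC "S_chi \<chi> :: 'a joint \<Rightarrow> 'a joint"
    by (rule S_chi_linear)
  show ?thesis
    using assms unfolding good_space_def
    by (induction rule: cvec.span_induct_alt) (auto simp: S.add S.scale S.zero S_chi_ket scaleC_one)
qed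

lemma S_chi_bad_space:
  assumes "v \<in> bad_space \<chi>"
  shows "S_chi \<chi> v = v"
proof -
  interpret S: Vector_Spaces.linear scaleC scaleC "S_chi \<chi> :: 'a joint \<Rightarrow> 'a joint"
    by (rule S_chi_linear)
  show ?thesis
    using assms unfolding bad_space_def
    by (induction rule: cvec.span_induct_alt) (auto simp: S.add S.scale S.zero S_chi_ket scaleC_one)
qed

text \<open>Unitarity gives \<open>cinner z (inv A y) = cinner (A z) y\<close>, so conjugating
  \<open>S_zero z\<close> by \<open>A\<close> yields the reflection \<open>S_zero (A z)\<close>; the
  leading minus sign of \<open>Q_op\<close> then swaps the two terms.\<close>

lemma Q_op_eq:
  assumes "is_unitary A"
  shows "Q_op A z \<chi> x = (2 * cinner (A z) (S_chi \<chi> x)) *\<^sub>C A z - S_chi \<chi> x"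
proof -
  interpret A: Vector_Spaces.linear scaleC scaleC A
    using assms by (simp add: is_unitary_def)
  let ?y = "S_chi \<chi> x"
  have inv: "A (inv A ?y) = ?y"
    using assms by (simp add: is_unitary_def bij_is_surj surj_f_inv_f)
  have "cinner z (inv A ?y) = cinner (A z) (A (inv A ?y))"
    using assms by (simp add: is_unitary_def)
  then have "cinner z (inv A ?y) = cinner (A z) ?y"
    by (simp only: inv)
  then show ?thesis
    by (simp add: Q_op_def S_zero_def A.diff A.scale inv)
qed

text \<open>\<open>S_chi\<close> negates only the good part, so the overlap of \<open>A z\<close>
  with the image is \<open>\<beta> * q - \<alpha> * p\<close>. The main proof takes the squares of
  sine and cosine for \<open>p\<close> and \<open>q\<close>.\<close>

lemma Q_op_good_bad:
  fixes g b :: "'k::complex_inner joint"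
  assumes "is_unitary A" "A z = g + b" "g \<in> good_space \<chi>" "b \<in> bad_space \<chi>"
    and "cinner (A z) g = p" "cinner (A z) b = q"
  shows "Q_op A z \<chi> (\<alpha> *\<^sub>C g + \<beta> *\<^sub>C b) =
    (\<alpha> + 2 * (\<beta> * q - \<alpha> * p)) *\<^sub>C g + (2 * (\<beta> * q - \<alpha> * p) - \<beta>) *\<^sub>C b"
proof -
  interpret S: Vector_Spaces.linear scaleC scaleC "S_chi \<chi> :: 'k joint \<Rightarrow> 'k joint"
    by (rule S_chi_linear)
  have S: "S_chi \<chi> (\<alpha> *\<^sub>C g + \<beta> *\<^sub>C b) = \<beta> *\<^sub>C b - \<alpha> *\<^sub>C g"
    using assms(3,4) by (simp add: S.add S.scale S_chi_good_space S_chi_bad_space)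
  have "cinner (A z) (\<beta> *\<^sub>C b - \<alpha> *\<^sub>C g) = \<beta> * q - \<alpha> * p"
    using assms(5,6) by (simp add: cinner_diff_right cinner_scaleC_right)
  then show ?thesis
    by (simp add: Q_op_eq[OF assms(1)] S assms(2) scaleC_add_right scaleC_add_left
        cvec.scale_left_diff_distrib)
qed

text \<open>
  In the next two lemmas the other divisor may vanish: with division by zero giving zero,
  \<open>cos x / cos \<theta> * (cos \<theta>)\<^sup>2\<close> is \<open>cos x * cos \<theta>\<close> in every case. This covers
  \<open>a = 0\<close> and \<open>a = 1\<close>.
\<close>

lemma sin_rotation_step:
  fixes \<theta> x :: real
  assumes "sin \<theta> \<noteq> 0"
  shows "sin (x + 2 * \<theta>) / sin \<theta> =
    sin x / sin \<theta> + 2 * (cos x / cos \<theta> * (cos \<theta>)\<^sup>2 - sin x / sin \<theta> * (sin \<theta>)\<^sup>2)"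
proof -
  have s: "sin (x + 2 * \<theta>) = sin x + 2 * (cos x * cos \<theta> * sin \<theta> - sin x * (sin \<theta>)\<^sup>2)"
    unfolding sin_add cos_double_sin sin_double by algebra
  have c: "cos x / cos \<theta> * (cos \<theta>)\<^sup>2 = cos x * cos \<theta>"
    by (simp add: power2_eq_square)
  show ?thesis
    using assms unfolding s c by (simp add: field_simps power2_eq_square)
qed

lemma cos_rotation_step:
  fixes \<theta> x :: real
  assumes "cos \<theta> \<noteq> 0"
  shows "cos (x + 2 * \<theta>) / cos \<theta> =
    2 * (cos x / cos \<theta> * (cos \<theta>)\<^sup>2 - sin x / sin \<theta> * (sin \<theta>)\<^sup>2) - cos x / cos \<theta>"
proof -
  have s: "cos (x + 2 * \<theta>) = 2 * (cos x * (cos \<theta>)\<^sup>2 - sin x * sin \<theta> * cos \<theta>) - cos x"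
    unfolding cos_add cos_double_cos sin_double by algebra
  have c: "sin x / sin \<theta> * (sin \<theta>)\<^sup>2 = sin x * sin \<theta>"
    by (simp add: power2_eq_square)
  show ?thesis
    using assms unfolding s c by (simp add: field_simps power2_eq_square)
qed

theorem theorem1:
  fixes A :: "'k::complex_inner joint \<Rightarrow> 'k joint"
    and ket0 \<Psi> \<Psi>a \<Psi>b :: "'k joint"
    and \<chi> :: "int \<Rightarrow> nat"
    and a \<theta> :: real
    and k l :: "nat \<Rightarrow> real"
  assumes "cinner ket0 ket0 = 1"
    and "is_unitary A"
    and "\<And>i. \<chi> i \<in> {0, 1}"
    and "\<Psi> = A ket0"
    and "\<Psi>a = orth_proj (good_space \<chi>) \<Psi>"
    and "\<Psi>b = orth_proj (bad_space \<chi>) \<Psi>"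
    and "complex_of_real a = cinner \<Psi>a \<Psi>a"
    and "(sin \<theta>)\<^sup>2 = a" and "0 \<le> \<theta>" and "\<theta> \<le> pi / 2"
    and "\<And>j. k j = 1 / sqrt a * sin ((2 * real j + 1) * \<theta>)"
    and "\<And>j. l j = 1 / sqrt (1 - a) * cos ((2 * real j + 1) * \<theta>)"
  shows "\<forall>j. (Q_op A ket0 \<chi> ^^ j) (A ket0) =
    complex_of_real (k j) *\<^sub>C \<Psi>a + complex_of_real (l j) *\<^sub>C \<Psi>b"
proof -
  note unit = assms(1) and A = assms(2) and \<chi> = assms(3) and \<Psi> = assms(4)
    and a = assms(7) and sin_a = assms(8) and \<theta> = assms(9,10)
  note orth = orth_proj_good_bad[where \<chi> = \<chi> and x = \<Psi>, OF \<chi>, folded assms(5,6)]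
  have \<Psi>a: "\<Psi>a \<in> good_space \<chi>" and \<Psi>b: "\<Psi>b \<in> bad_space \<chi>"
    using orth(1,2) by (simp_all add: is_orth_proj_def)
  have diff: "\<Psi> - \<Psi>b = \<Psi>a"
    by (subst orth(3)) simp
  \<comment> \<open>By \<open>diff\<close>, the residual of the projection onto the bad space is
    \<open>\<Psi>a\<close>; it is tested against \<open>\<Psi>b\<close> itself.\<close>
  have ba: "cinner \<Psi>b \<Psi>a = 0"
    using orth(2) \<Psi>b by (simp add: is_orth_proj_def diff)
  then have ab: "cinner \<Psi>a \<Psi>b = 0"
    using cinner_commute[of \<Psi>a \<Psi>b] by simp
  have \<Psi>\<Psi>: "cinner \<Psi> \<Psi> = 1"
    using A unit by (simp add: \<Psi> is_unitary_def)
  have p: "cinner \<Psi> \<Psi>a = complex_of_real ((sin \<theta>)\<^sup>2)"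
    by (subst orth(3)) (simp only: cinner_add_left ba a[symmetric] sin_a add_0_right)
  have bb: "cinner \<Psi> \<Psi>b = cinner \<Psi>b \<Psi>b"
    by (subst orth(3)) (simp only: cinner_add_left ab add_0_left)
  have "cinner \<Psi> \<Psi>a + cinner \<Psi> \<Psi>b = 1"
    using \<Psi>\<Psi> by (simp only: cinner_add_right[symmetric] orth(3)[symmetric])
  then have q: "cinner \<Psi> \<Psi>b = complex_of_real ((cos \<theta>)\<^sup>2)"
    by (simp add: p cos_squared_eq algebra_simps)
  \<comment> \<open>The degenerate cases: the squared norm of the component is the square of the
    sine, respectively cosine, so the component vanishes with it.\<close>
  have \<Psi>a_0: "\<Psi>a = 0" if "sin \<theta> = 0"
    using that a sin_a by (simp add: cinner_eq_zero_iff flip: sin_a)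
  have \<Psi>b_0: "\<Psi>b = 0" if "cos \<theta> = 0"
    using that q bb by (simp add: cinner_eq_zero_iff)
  \<comment> \<open>The range of \<theta> fixes the signs, so that
    \<open>sqrt a = sin \<theta>\<close> and \<open>sqrt (1 - a) = cos \<theta>\<close>.\<close>
  have "0 \<le> sin \<theta>" "0 \<le> cos \<theta>"
    using \<theta> by (auto intro: sin_ge_zero cos_ge_zero)
  then have k: "k j = sin ((2 * real j + 1) * \<theta>) / sin \<theta>"
    and l: "l j = cos ((2 * real j + 1) * \<theta>) / cos \<theta>" for j
    by (simp_all add: assms(11,12) cos_squared_eq[symmetric] flip: sin_a)
  have angle: "(2 * real (Suc j) + 1) * \<theta> = (2 * real j + 1) * \<theta> + 2 * \<theta>" for j
    by (simp add: algebra_simps)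
  show ?thesis
  proof
    fix j
    show "(Q_op A ket0 \<chi> ^^ j) (A ket0) =
      complex_of_real (k j) *\<^sub>C \<Psi>a + complex_of_real (l j) *\<^sub>C \<Psi>b"
    proof (induction j)
      case 0
      \<comment> \<open>At \<open>j = 0\<close> the angle is \<theta> itself: the coefficient is 1
        unless its divisor is 0, and then the vector is 0.\<close>
      have "complex_of_real (k 0) *\<^sub>C \<Psi>a = \<Psi>a"
        using \<Psi>a_0 by (cases "sin \<theta> = 0") (simp_all add: k scaleC_one)
      moreover have "complex_of_real (l 0) *\<^sub>C \<Psi>b = \<Psi>b"
        using \<Psi>b_0 by (cases "cos \<theta> = 0") (simp_all add: l scaleC_one)
      ultimately show ?case
        using orth(3) \<Psi> by simp
    next
      case (Suc j)
      \<comment> \<open>The multiple of \<open>\<Psi>\<close> that \<open>Q\<close> adds to both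
        components.\<close>
      let ?d = "2 * (l j * (cos \<theta>)\<^sup>2 - k j * (sin \<theta>)\<^sup>2)"
      have "(Q_op A ket0 \<chi> ^^ Suc j) (A ket0) =
          complex_of_real (k j + ?d) *\<^sub>C \<Psi>a + complex_of_real (?d - l j) *\<^sub>C \<Psi>b"
        using Q_op_good_bad[OF A orth(3)[unfolded \<Psi>] _ _ p[unfolded \<Psi>] q[unfolded \<Psi>]] \<Psi>a \<Psi>b
        by (simp add: Suc.IH)
      \<comment> \<open>Only the scaled vectors are compared: for \<open>sin \<theta> = 0\<close>
        the scalars differ (\<open>k j + ?d = 2\<close> but \<open>k (Suc j) = 0\<close>), while
        \<open>\<Psi>a = 0\<close>. The bad component is treated likewise.\<close>
      moreover have "complex_of_real (k j + ?d) *\<^sub>C \<Psi>a = complex_of_real (k (Suc j)) *\<^sub>C \<Psi>a"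
      proof (cases "sin \<theta> = 0")
        case False
        then show ?thesis
          by (simp only: k l angle sin_rotation_step[OF False])
      qed (simp add: \<Psi>a_0)
      moreover have "complex_of_real (?d - l j) *\<^sub>C \<Psi>b = complex_of_real (l (Suc j)) *\<^sub>C \<Psi>b"
      proof (cases "cos \<theta> = 0")
        case False
        then show ?thesis
          by (simp only: k l angle cos_rotation_step[OF False])
      qed (simp add: \<Psi>b_0)
      ultimately show ?case
        by (simp only:)
    qed
  qed
qed

end
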